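(* For every $k\ge 2$, the inverse monoid ${\it Inv}_{k,1}$ is finitely generated.
   Context: Let $k\ge 2$ and $A=\{a_1,\dots,a_k\}$ an alphabet; $A^*$ is the set of all finite words over $A$, with empty word $\varepsilon$. A right ideal of $A^*$ is a set $R\subseteq A^*$ with $RA^*\subseteq R$ (the empty set is allowed). A prefix code is a set $C\subseteq A^*$ in which no element is a prefix of another element. Every right ideal $R$ equals $CA^*$ for a unique prefix code $C$; $R$ is finitely generated iff $C$ is finite. A right ideal homomorphism is a total function $\varphi: R_1\to A^*$, where $R_1={\rm Dom}(\varphi)$ is a right ideal, with $\varphi(xw)=\varphi(x)w$ for all $x\in R_1$, $w\in A^*$; an injective one is called a right ideal isomorphism (onto its image). For right ideals $R'\subseteq R$, $R'$ is essential in $R$ iff $R'$ intersects every non-empty right ideal contained in $R$. $\varphi$ is an essential extension of $\Phi$ iff ${\rm Dom}(\Phi)$ is contained and essential in ${\rm Dom}(\varphi)$ and $\varphi=\Phi$ on ${\rm Dom}(\Phi)$. Every right ideal homomorphism $\varphi$ with finitely generated domain has a unique maximal essential extension $\max(\varphi)$. ${\it Inv}_{k,1}$ is the monoid of all maximal essential extensions of isomorphisms between finitely generated (not necessarily essential) right ideals of $A^*$, with multiplication $\varphi\cdot\psi=\max(\varphi\circ\psi)$. *)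

theory Defs
  imports "HOL-Algebra.Group"
begin

text \<open>The alphabet is the type \<open>'a\<close> and words are lists, so \<open>'a list\<close> plays the role of
  \<open>A\<^sup>*\<close>. A function defined on a right ideal is a partial map \<open>'a list \<rightharpoonup> 'a list\<close>.\<close>

definition right_ideal :: "'a list set \<Rightarrow> bool" where
  "right_ideal R \<longleftrightarrow> (\<forall>x\<in>R. \<forall>w. x @ w \<in> R)"

definition ideal_gen :: "'a list set \<Rightarrow> 'a list set" where
  "ideal_gen C = {c @ w | c w. c \<in> C}"

definition fg_right_ideal :: "'a list set \<Rightarrow> bool" where
  "fg_right_ideal R \<longleftrightarrow> (\<exists>C. finite C \<and> R = ideal_gen C)"

definition essential_in :: "'a list set \<Rightarrow> 'a list set \<Rightarrow> bool" where
  "essential_in R' R \<longleftrightarrow> R' \<subseteq> R \<and> (\<forall>I. right_ideal I \<and> I \<noteq> {} \<and> I \<subseteq> R \<longrightarrow> R' \<inter> I \<noteq> {})"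

definition ideal_hom :: "('a list \<rightharpoonup> 'a list) \<Rightarrow> bool" where
  "ideal_hom \<phi> \<longleftrightarrow> right_ideal (dom \<phi>) \<and> (\<forall>x\<in>dom \<phi>. \<forall>w. \<phi> (x @ w) = Some (the (\<phi> x) @ w))"

definition ideal_iso :: "('a list \<rightharpoonup> 'a list) \<Rightarrow> bool" where
  "ideal_iso \<phi> \<longleftrightarrow> ideal_hom \<phi> \<and> inj_on \<phi> (dom \<phi>)"

definition essential_extension :: "('a list \<rightharpoonup> 'a list) \<Rightarrow> ('a list \<rightharpoonup> 'a list) \<Rightarrow> bool" where
  "essential_extension \<phi> \<Phi> \<longleftrightarrow> ideal_hom \<phi> \<and> ideal_hom \<Phi> \<and>
     essential_in (dom \<Phi>) (dom \<phi>) \<and> (\<forall>x\<in>dom \<Phi>. \<phi> x = \<Phi> x)"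

definition maximal_essential_extension ::
    "('a list \<rightharpoonup> 'a list) \<Rightarrow> ('a list \<rightharpoonup> 'a list) \<Rightarrow> bool" where
  "maximal_essential_extension \<phi> \<Phi> \<longleftrightarrow> essential_extension \<phi> \<Phi> \<and>
     (\<forall>\<psi>. essential_extension \<psi> \<Phi> \<and> \<phi> \<subseteq>\<^sub>m \<psi> \<longrightarrow> \<psi> = \<phi>)"

definition max_ext :: "('a list \<rightharpoonup> 'a list) \<Rightarrow> ('a list \<rightharpoonup> 'a list)" where
  "max_ext \<Phi> = (THE \<phi>. maximal_essential_extension \<phi> \<Phi>)"

definition Inv_monoid :: "('a list \<rightharpoonup> 'a list) monoid" where
  "Inv_monoid =
     \<lparr>carrier = {max_ext \<Phi> | \<Phi>. ideal_iso \<Phi> \<and> fg_right_ideal (dom \<Phi>) \<and> fg_right_ideal (ran \<Phi>)},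
      monoid.mult = (\<lambda>\<phi> \<psi>. max_ext (\<phi> \<circ>\<^sub>m \<psi>)),
      one = Some\<rparr>"

definition finitely_generated_monoid :: "('b, 'c) monoid_scheme \<Rightarrow> bool" where
  "finitely_generated_monoid M \<longleftrightarrow> monoid M \<and>
     (\<exists>S. finite S \<and> S \<subseteq> carrier M \<and> \<Inter>{H. submonoid H M \<and> S \<subseteq> H} = carrier M)"

text \<open>The definite description in \<^const>\<open>max_ext\<close> denotes, even without finite generation
  of the domain.\<close>

lemma essential_in_extend:
  assumes "essential_in R' R" "right_ideal R" "x \<in> R"
  obtains w where "x @ w \<in> R'"
proof -
  have "right_ideal {x @ w | w. True}" unfolding right_ideal_def by auto
  moreover have "{x @ w | w. True} \<subseteq> R" "{x @ w | w. True} \<noteq> {}"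
    using assms unfolding right_ideal_def by auto
  ultimately have "R' \<inter> {x @ w | w. True} \<noteq> {}"
    using assms(1) unfolding essential_in_def by blast
  then show thesis using that by blast
qed

lemma essential_inI:
  assumes "R' \<subseteq> R" "\<And>x. x \<in> R \<Longrightarrow> \<exists>w. x @ w \<in> R'"
  shows "essential_in R' R"
  unfolding essential_in_def
proof (intro conjI allI impI)
  fix I assume I: "right_ideal I \<and> I \<noteq> {} \<and> I \<subseteq> R"
  then obtain x where "x \<in> I" by blast
  then obtain w where "x @ w \<in> R'" using assms(2) I by blast
  then show "R' \<inter> I \<noteq> {}" using I \<open>x \<in> I\<close> unfolding right_ideal_def by blast
qed (rule assms(1))

lemma ideal_hom_append:
  assumes "ideal_hom \<phi>" "\<phi> x = Some y"
  shows "\<phi> (x @ w) = Some (y @ w)"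
proof -
  have "x \<in> dom \<phi>" using assms(2) by blast
  then have "\<phi> (x @ w) = Some (the (\<phi> x) @ w)" using assms(1) unfolding ideal_hom_def by blast
  then show ?thesis using assms(2) by simp
qed

lemma essential_extension_agree:
  assumes 1: "essential_extension \<phi> \<Phi>" and 2: "essential_extension \<psi> \<Phi>"
    and y: "\<phi> x = Some y" and z: "\<psi> x = Some z"
  shows "y = z"
proof -
  obtain w where w: "x @ w \<in> dom \<Phi>"
    using essential_in_extend[of "dom \<Phi>" "dom \<phi>" x] 1 y
    unfolding essential_extension_def ideal_hom_def by blast
  have "\<phi> (x @ w) = Some (y @ w)" "\<psi> (x @ w) = Some (z @ w)"
    using ideal_hom_append 1 2 y z unfolding essential_extension_def by blast+
  moreover have "\<phi> (x @ w) = \<psi> (x @ w)"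
    using 1 2 w unfolding essential_extension_def by metis
  ultimately show ?thesis by simp
qed

lemma greatest_essential_extension:
  assumes \<Phi>: "ideal_hom \<Phi>"
  obtains \<mu> where "essential_extension \<mu> \<Phi>" "\<And>\<psi>. essential_extension \<psi> \<Phi> \<Longrightarrow> \<psi> \<subseteq>\<^sub>m \<mu>"
proof -
  let ?P = "\<lambda>x y. \<exists>\<psi>. essential_extension \<psi> \<Phi> \<and> \<psi> x = Some y"
  define \<mu> where "\<mu> x = (if \<exists>y. ?P x y then Some (SOME y. ?P x y) else None)" for x
  have uniq: "y = z" if "?P x y" "?P x z" for x y z
    using essential_extension_agree that by blast
  have \<mu>: "\<mu> x = Some y \<longleftrightarrow> ?P x y" for x y
  proof (cases "\<exists>y. ?P x y")
    case True
    define z where "z = (SOME y. ?P x y)"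
    have z: "?P x z" unfolding z_def using True by (rule someI_ex)
    have "\<mu> x = Some z" unfolding \<mu>_def if_P[OF True] z_def ..
    moreover have "z = y" if "?P x y" using z that by (rule uniq)
    ultimately show ?thesis using z by fastforce
  next
    case False
    then show ?thesis unfolding \<mu>_def if_not_P[OF False] by simp
  qed
  have app: "\<mu> (x @ w) = Some (y @ w)" if xy: "\<mu> x = Some y" for x y w
  proof -
    obtain \<psi> where \<psi>: "essential_extension \<psi> \<Phi>" "\<psi> x = Some y" using xy \<mu> by blast
    then have "\<psi> (x @ w) = Some (y @ w)"
      using ideal_hom_append unfolding essential_extension_def by blast
    then show ?thesis using \<psi>(1) \<mu> by blast
  qed
  have hom: "ideal_hom \<mu>"
    unfolding ideal_hom_def right_ideal_def using app by (auto simp: dom_def)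
  have "essential_in (dom \<Phi>) (dom \<Phi>)"
    unfolding essential_in_def by (simp add: inf.absorb_iff2)
  then have self: "essential_extension \<Phi> \<Phi>"
    using \<Phi> unfolding essential_extension_def by simp
  have ext: "\<mu> x = \<Phi> x" if x: "x \<in> dom \<Phi>" for x
  proof -
    obtain y where y: "\<Phi> x = Some y" using x by blast
    then have "\<mu> x = Some y" using self \<mu> by blast
    with y show ?thesis by simp
  qed
  have "essential_in (dom \<Phi>) (dom \<mu>)"
  proof (rule essential_inI)
    show "dom \<Phi> \<subseteq> dom \<mu>" using ext by (auto simp: dom_def)
    fix x assume "x \<in> dom \<mu>"
    then obtain y where "\<mu> x = Some y" by blast
    then obtain \<psi> where "essential_extension \<psi> \<Phi>" "\<psi> x = Some y" unfolding \<mu> by blast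
    then have "essential_in (dom \<Phi>) (dom \<psi>)" "right_ideal (dom \<psi>)" "x \<in> dom \<psi>"
      unfolding essential_extension_def ideal_hom_def by auto
    then show "\<exists>w. x @ w \<in> dom \<Phi>" using essential_in_extend by metis
  qed
  then have "essential_extension \<mu> \<Phi>"
    using hom \<Phi> ext unfolding essential_extension_def by simp
  moreover have "\<psi> \<subseteq>\<^sub>m \<mu>" if "essential_extension \<psi> \<Phi>" for \<psi>
  proof (unfold map_le_def, rule ballI)
    fix x assume "x \<in> dom \<psi>"
    then obtain y where y: "\<psi> x = Some y" by auto
    then have "\<mu> x = Some y" using that \<mu> by blast
    with y show "\<psi> x = \<mu> x" by simp
  qed
  ultimately show thesis using that by blast
qed

lemma ex1_maximal_essential_extension:
  assumes "ideal_hom \<Phi>"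
  shows "\<exists>!\<phi>. maximal_essential_extension \<phi> \<Phi>"
proof -
  obtain \<mu> where \<mu>: "essential_extension \<mu> \<Phi>" "\<And>\<psi>. essential_extension \<psi> \<Phi> \<Longrightarrow> \<psi> \<subseteq>\<^sub>m \<mu>"
    using greatest_essential_extension[OF assms] by blast
  then have "maximal_essential_extension \<mu> \<Phi>"
    unfolding maximal_essential_extension_def using map_le_antisym by blast
  moreover have "\<phi> = \<mu>" if "maximal_essential_extension \<phi> \<Phi>" for \<phi>
    using that \<mu> unfolding maximal_essential_extension_def by blast
  ultimately show ?thesis by blast
qed

end

theory Submission
  imports Defs "HOL-Library.Sublist"
begin

text \<open>Passing to maximal extensions is a congruence: a domain that is essential stays essential
  under composition (\<open>max_ext_comp\<close>). Associativity of the product is therefore inherited from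
  composition of partial maps, and to generate the monoid it is enough to write every isomorphism
  between finitely generated right ideals as an ordinary composite of finitely many fixed ones and
  their inverses.

  Such an isomorphism \<open>\<phi>\<close> is given by a table \<open>x\<^sub>i \<mapsto> y\<^sub>i\<close> (\<open>i < n\<close>) between two prefix codes.
  Fix letters \<open>a \<noteq> b\<close>. The infinite prefix code of all \<open>a\<^sup>i b\<close> has a subcode \<open>{a\<^sup>i b | i < n}\<close> for
  every \<open>n\<close>, so \<open>\<phi>\<close> is the map \<open>x\<^sub>i \<mapsto> a\<^sup>i b\<close> followed by the inverse of \<open>y\<^sub>i \<mapsto> a\<^sup>i b\<close>
  (\<open>factorization\<close>). Only these enumeration maps have to be generated.

  To enumerate a code, think of the words beginning with \<open>a\<close> as a store and of those beginning
  with \<open>b\<close> as the input still to be treated. First \<open>w \<mapsto> b w\<close> declares everything input. Then,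
  for one code word \<open>x\<close> after another, the map \<open>pick x\<close> shifts the store by one letter \<open>a\<close> and
  moves the cone of \<open>b x\<close> to the place \<open>a b\<close> that this has left free. In the end the code words
  sit at \<open>a a\<^sup>i b\<close>, and \<open>a w \<mapsto> w\<close> removes the leading letter and discards the untreated input.

  The maps \<open>pick x\<close> depend on an arbitrary word, but they satisfy the recursion
  \<open>pick (c x) = unpark c \<circ> pick x \<circ> park c\<close>: the input that does not begin with \<open>c\<close> is parked inside
  the store, where \<open>pick x\<close> only shifts it, and is brought back afterwards. So finitely many maps
  suffice: the two cone maps, \<open>pick \<epsilon>\<close>, and one pair of parking maps for each letter.\<close>

section \<open>Maximal extensions and composition\<close>

lemma max_ext_props:
  assumes "ideal_hom \<Phi>"
  shows max_ext_essential: "essential_extension (max_ext \<Phi>) \<Phi>"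
    and max_ext_greatest: "essential_extension \<psi> \<Phi> \<Longrightarrow> \<psi> \<subseteq>\<^sub>m max_ext \<Phi>"
proof -
  obtain \<mu> where \<mu>: "essential_extension \<mu> \<Phi>" "\<And>\<psi>. essential_extension \<psi> \<Phi> \<Longrightarrow> \<psi> \<subseteq>\<^sub>m \<mu>"
    using greatest_essential_extension[OF assms] by blast
  then have "maximal_essential_extension \<mu> \<Phi>"
    unfolding maximal_essential_extension_def using map_le_antisym by blast
  then have "max_ext \<Phi> = \<mu>"
    unfolding max_ext_def using ex1_maximal_essential_extension[OF assms] by (metis the1_equality)
  with \<mu> show "essential_extension (max_ext \<Phi>) \<Phi>"
    and "essential_extension \<psi> \<Phi> \<Longrightarrow> \<psi> \<subseteq>\<^sub>m max_ext \<Phi>" by simp_all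
qed

lemma ideal_homI:
  assumes "\<And>x y w. \<phi> x = Some y \<Longrightarrow> \<phi> (x @ w) = Some (y @ w)"
  shows "ideal_hom \<phi>"
  unfolding ideal_hom_def right_ideal_def using assms by (auto simp: dom_def)

lemma essential_extensionI:
  assumes "ideal_hom \<phi>" "ideal_hom \<Phi>" "\<And>x y. \<Phi> x = Some y \<Longrightarrow> \<phi> x = Some y"
    and "\<And>x y. \<phi> x = Some y \<Longrightarrow> \<exists>w. x @ w \<in> dom \<Phi>"
  shows "essential_extension \<phi> \<Phi>"
  unfolding essential_extension_def using assms by (force intro!: essential_inI)

lemma essential_extensionD:
  assumes "essential_extension \<phi> \<Phi>"
  shows "ideal_hom \<phi>" "ideal_hom \<Phi>"
    and "\<Phi> x = Some y \<Longrightarrow> \<phi> x = Some y"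
    and "\<phi> x = Some y \<Longrightarrow> \<exists>w. \<Phi> (x @ w) = Some (y @ w)"
proof -
  note e = assms[unfolded essential_extension_def]
  from e show h: "ideal_hom \<phi>" "ideal_hom \<Phi>" by auto
  from e show "\<Phi> x = Some y \<Longrightarrow> \<phi> x = Some y" by (metis domI)
  assume y: "\<phi> x = Some y"
  then obtain w where w: "x @ w \<in> dom \<Phi>"
    using essential_in_extend[of "dom \<Phi>" "dom \<phi>" x] e unfolding ideal_hom_def by blast
  then have "\<Phi> (x @ w) = Some (y @ w)" using e ideal_hom_append[OF h(1) y, of w] by auto
  then show "\<exists>w. \<Phi> (x @ w) = Some (y @ w)" ..
qed

lemma essential_extension_trans:
  assumes "essential_extension \<chi> \<psi>" "essential_extension \<psi> \<phi>"
  shows "essential_extension \<chi> \<phi>"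
proof (rule essential_extensionI)
  fix x y assume "\<chi> x = Some y"
  then obtain w where "\<psi> (x @ w) = Some (y @ w)" using essential_extensionD(4)[OF assms(1)] by blast
  then obtain v where "\<phi> ((x @ w) @ v) = Some ((y @ w) @ v)"
    using essential_extensionD(4)[OF assms(2)] by blast
  then show "\<exists>w. x @ w \<in> dom \<phi>" by (auto simp: dom_def)
qed (use assms essential_extensionD in blast)+

text \<open>By transitivity, the greatest essential extension of \<open>\<phi>\<close> is one of \<open>\<Phi>\<close>. Conversely, the
  greatest one of \<open>\<Phi>\<close> extends \<open>\<phi>\<close>, and essentially so because already \<open>dom \<Phi>\<close> is dense in it.\<close>

lemma max_ext_eq:
  assumes e: "essential_extension \<phi> \<Phi>"
  shows "max_ext \<phi> = max_ext \<Phi>"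
proof (rule map_le_antisym)
  note h = essential_extensionD(1,2)[OF e]
  show "max_ext \<phi> \<subseteq>\<^sub>m max_ext \<Phi>"
    by (rule max_ext_greatest[OF h(2)]) (rule essential_extension_trans[OF max_ext_essential[OF h(1)] e])
  show "max_ext \<Phi> \<subseteq>\<^sub>m max_ext \<phi>"
  proof (rule max_ext_greatest[OF h(1)], rule essential_extensionI)
    show "ideal_hom (max_ext \<Phi>)" using max_ext_essential[OF h(2)] essential_extensionD(1) by blast
    show "ideal_hom \<phi>" by (rule h)
    show "max_ext \<Phi> x = Some y" if "\<phi> x = Some y" for x y
      using that max_ext_greatest[OF h(2) e] by (metis domI map_le_def)
    show "\<exists>w. x @ w \<in> dom \<phi>" if "max_ext \<Phi> x = Some y" for x y
      using essential_extensionD(4)[OF max_ext_essential[OF h(2)] that] essential_extensionD(3)[OF e]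
      by blast
  qed
qed

lemma ideal_hom_comp: "ideal_hom \<phi> \<Longrightarrow> ideal_hom \<psi> \<Longrightarrow> ideal_hom (\<phi> \<circ>\<^sub>m \<psi>)"
  by (rule ideal_homI) (auto simp: map_comp_Some_iff ideal_hom_append)

text \<open>Density survives composition: extend the argument until the inner map is defined on it,
  then extend it further until the image lies in the domain of the outer map.\<close>

lemma essential_extension_comp:
  assumes "essential_extension \<phi>' \<phi>" "essential_extension \<psi>' \<psi>"
  shows "essential_extension (\<phi>' \<circ>\<^sub>m \<psi>') (\<phi> \<circ>\<^sub>m \<psi>)"
proof (rule essential_extensionI)
  note h = essential_extensionD(1,2)[OF assms(1)] essential_extensionD(1,2)[OF assms(2)]
  show "ideal_hom (\<phi>' \<circ>\<^sub>m \<psi>')" "ideal_hom (\<phi> \<circ>\<^sub>m \<psi>)" using h by (simp_all add: ideal_hom_comp)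
  show "(\<phi>' \<circ>\<^sub>m \<psi>') x = Some y" if "(\<phi> \<circ>\<^sub>m \<psi>) x = Some y" for x y
    using that essential_extensionD(3)[OF assms(1)] essential_extensionD(3)[OF assms(2)]
    by (auto simp: map_comp_Some_iff)
  fix x z assume "(\<phi>' \<circ>\<^sub>m \<psi>') x = Some z"
  then obtain y where y: "\<psi>' x = Some y" "\<phi>' y = Some z" by (auto simp: map_comp_Some_iff)
  obtain w where w: "\<psi> (x @ w) = Some (y @ w)" using essential_extensionD(4)[OF assms(2) y(1)] ..
  have "\<phi>' (y @ w) = Some (z @ w)" using h(1) y(2) by (rule ideal_hom_append)
  then obtain v where "\<phi> ((y @ w) @ v) = Some ((z @ w) @ v)"
    using essential_extensionD(4)[OF assms(1)] by blast
  moreover have "\<psi> ((x @ w) @ v) = Some ((y @ w) @ v)" using h(4) w by (rule ideal_hom_append)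
  ultimately have "(\<phi> \<circ>\<^sub>m \<psi>) (x @ (w @ v)) = Some (z @ w @ v)" by (simp add: map_comp_Some_iff)
  then show "\<exists>w. x @ w \<in> dom (\<phi> \<circ>\<^sub>m \<psi>)" by blast
qed

lemma max_ext_comp:
  assumes "ideal_hom \<phi>" "ideal_hom \<psi>"
  shows "max_ext (max_ext \<phi> \<circ>\<^sub>m max_ext \<psi>) = max_ext (\<phi> \<circ>\<^sub>m \<psi>)"
  using assms by (intro max_ext_eq essential_extension_comp max_ext_essential)

section \<open>Isomorphisms with finitely generated domain\<close>

definition fg_iso :: "('a list \<rightharpoonup> 'a list) \<Rightarrow> bool" where
  "fg_iso \<phi> \<longleftrightarrow> ideal_iso \<phi> \<and> fg_right_ideal (dom \<phi>)"

lemma ideal_isoI: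
  assumes "\<And>x y w. \<phi> x = Some y \<Longrightarrow> \<phi> (x @ w) = Some (y @ w)"
    and "\<And>x x' y. \<phi> x = Some y \<Longrightarrow> \<phi> x' = Some y \<Longrightarrow> x = x'"
  shows "ideal_iso \<phi>"
  unfolding ideal_iso_def using ideal_homI[of \<phi>] assms by (auto simp: inj_on_def dom_def)

lemma ideal_iso_inj:
  assumes "ideal_iso \<phi>" "\<phi> x = Some y" "\<phi> x' = Some y"
  shows "x = x'"
  using assms unfolding ideal_iso_def by (metis domI inj_onD)

lemma fg_iso_hom: "fg_iso \<phi> \<Longrightarrow> ideal_hom \<phi>"
  by (simp add: fg_iso_def ideal_iso_def)

lemma fg_iso_inj: "fg_iso \<phi> \<Longrightarrow> \<phi> x = Some y \<Longrightarrow> \<phi> x' = Some y \<Longrightarrow> x = x'"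
  unfolding fg_iso_def using ideal_iso_inj by blast

text \<open>Finite generation of the range follows from that of the domain, so \<open>fg_iso\<close> captures
  exactly the isomorphisms from which the monoid is built.\<close>

lemma fg_right_ideal_ran:
  assumes "ideal_hom \<phi>" "fg_right_ideal (dom \<phi>)"
  shows "fg_right_ideal (ran \<phi>)"
proof -
  obtain C where C: "finite C" "dom \<phi> = ideal_gen C"
    using assms(2) unfolding fg_right_ideal_def by blast
  have c: "\<exists>y. \<phi> c = Some y" if "c \<in> C" for c
  proof -
    have "c \<in> dom \<phi>" unfolding C ideal_gen_def using that by (auto intro: exI[of _ "[]"])
    then show ?thesis by blast
  qed
  have "ran \<phi> = ideal_gen ((\<lambda>c. the (\<phi> c)) ` C)"
  proof (rule subset_antisym; rule subsetI)
    fix y assume "y \<in> ran \<phi>"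
    then obtain x where x: "\<phi> x = Some y" unfolding ran_def by blast
    then have "x \<in> ideal_gen C" using C(2) by blast
    then obtain d w where d: "d \<in> C" "x = d @ w" unfolding ideal_gen_def by blast
    then obtain z where "\<phi> d = Some z" using c by blast
    then have "y = the (\<phi> d) @ w" using ideal_hom_append[OF assms(1)] x d by fastforce
    then show "y \<in> ideal_gen ((\<lambda>c. the (\<phi> c)) ` C)" unfolding ideal_gen_def using d by blast
  next
    fix y assume "y \<in> ideal_gen ((\<lambda>c. the (\<phi> c)) ` C)"
    then obtain d w where d: "d \<in> C" "y = the (\<phi> d) @ w" unfolding ideal_gen_def by blast
    then obtain z where "\<phi> d = Some z" using c by blast
    then have "\<phi> (d @ w) = Some y" using ideal_hom_append[OF assms(1)] d by fastforce
    then show "y \<in> ran \<phi>" by (rule ranI)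
  qed
  then show ?thesis unfolding fg_right_ideal_def using C(1) by blast
qed

lemma carrier_Inv_monoid: "carrier Inv_monoid = max_ext ` {\<Phi>. fg_iso \<Phi>}"
  unfolding Inv_monoid_def fg_iso_def ideal_iso_def using fg_right_ideal_ran by auto

lemma fg_iso_comp:
  assumes \<phi>: "fg_iso \<phi>" and \<psi>: "fg_iso \<psi>"
  shows "fg_iso (\<phi> \<circ>\<^sub>m \<psi>)"
proof -
  note h = fg_iso_hom[OF \<phi>] fg_iso_hom[OF \<psi>]
  have iso: "ideal_iso (\<phi> \<circ>\<^sub>m \<psi>)"
    by (rule ideal_isoI)
      (auto simp: map_comp_Some_iff ideal_hom_append h dest: fg_iso_inj[OF \<phi>] fg_iso_inj[OF \<psi>])
  obtain C where C: "finite C" "dom \<psi> = ideal_gen C"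
    using \<psi> unfolding fg_iso_def fg_right_ideal_def by blast
  obtain D where D: "finite D" "dom \<phi> = ideal_gen D"
    using \<phi> unfolding fg_iso_def fg_right_ideal_def by blast
  (* An overlap of a generator q of dom \<phi> with the image of a generator c of dom \<psi> lifts to
     the word c followed by the part of q that sticks out of that image. *)
  let ?E = "dom (\<phi> \<circ>\<^sub>m \<psi>) \<inter> (C \<union> (\<lambda>(c, q). c @ drop (length (the (\<psi> c))) q) ` (C \<times> D))"
  have "dom (\<phi> \<circ>\<^sub>m \<psi>) = ideal_gen ?E"
  proof (rule subset_antisym; rule subsetI)
    fix x assume "x \<in> dom (\<phi> \<circ>\<^sub>m \<psi>)"
    then obtain y z where y: "\<psi> x = Some y" and z: "\<phi> y = Some z"
      by (auto simp: map_comp_Some_iff)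
    obtain c w where c: "c \<in> C" "x = c @ w"
      using y C(2) unfolding ideal_gen_def by blast
    have "c \<in> dom \<psi>" unfolding C ideal_gen_def using c by (auto intro: exI[of _ "[]"])
    then obtain u where u: "\<psi> c = Some u" by blast
    then have yu: "y = u @ w" using ideal_hom_append[OF h(2) u, of w] y c by simp
    obtain q v where q: "q \<in> D" "y = q @ v"
      using z D(2) unfolding ideal_gen_def by blast
    have "q \<in> dom \<phi>" unfolding D ideal_gen_def using q by (auto intro: exI[of _ "[]"])
    then obtain r where r: "\<phi> q = Some r" by blast
    from yu q(2) have "prefix q u \<or> prefix u q" by (metis prefixI prefix_same_cases)
    then show "x \<in> ideal_gen ?E"
    proof
      assume "prefix q u"
      then obtain t where "u = q @ t" by (auto simp: prefix_def)
      then have "\<phi> u = Some (r @ t)" using ideal_hom_append[OF h(1) r] by simp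
      then have "(\<phi> \<circ>\<^sub>m \<psi>) c = Some (r @ t)" using u by (simp add: map_comp_Some_iff)
      then have "c \<in> ?E" using c by blast
      then show ?thesis using c unfolding ideal_gen_def by blast
    next
      assume "prefix u q"
      then obtain t where t: "q = u @ t" by (auto simp: prefix_def)
      then have "(\<phi> \<circ>\<^sub>m \<psi>) (c @ t) = Some r"
        using ideal_hom_append[OF h(2) u] r by (simp add: map_comp_Some_iff)
      moreover have "c @ t = (case (c, q) of (c, q) \<Rightarrow> c @ drop (length (the (\<psi> c))) q)"
        using u t by simp
      ultimately have "c @ t \<in> ?E" using c q by blast
      moreover have "x = (c @ t) @ v" using yu q t c by simp
      ultimately show ?thesis unfolding ideal_gen_def by blast
    qed
  next
    fix x assume "x \<in> ideal_gen ?E"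
    then show "x \<in> dom (\<phi> \<circ>\<^sub>m \<psi>)"
      using iso unfolding ideal_gen_def ideal_iso_def ideal_hom_def right_ideal_def by blast
  qed
  moreover have "finite ?E" using C D by auto
  ultimately show ?thesis using iso unfolding fg_iso_def fg_right_ideal_def by blast
qed

lemma fg_iso_Some: "fg_iso Some"
proof -
  have "dom (Some :: 'a list \<rightharpoonup> 'a list) = ideal_gen {[]}" by (auto simp: ideal_gen_def)
  then show ?thesis
    unfolding fg_iso_def fg_right_ideal_def by (auto intro!: ideal_isoI exI[of _ "{[]}"])
qed

lemma max_ext_Some: "max_ext Some = Some"
proof
  fix x :: "'a list"
  show "max_ext Some x = Some x"
    using essential_extensionD(3)[OF max_ext_essential[OF fg_iso_hom[OF fg_iso_Some]]] by simp
qed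

lemma monoid_Inv_monoid: "monoid (Inv_monoid :: ('a list \<rightharpoonup> 'a list) monoid)"
proof -
  let ?M = "Inv_monoid :: ('a list \<rightharpoonup> 'a list) monoid"
  have mult: "max_ext \<phi> \<otimes>\<^bsub>?M\<^esub> max_ext \<psi> = max_ext (\<phi> \<circ>\<^sub>m \<psi>)" if "fg_iso \<phi>" "fg_iso \<psi>" for \<phi> \<psi>
    using max_ext_comp[OF that[THEN fg_iso_hom]] by (simp add: Inv_monoid_def)
  have one: "\<one>\<^bsub>?M\<^esub> = max_ext Some" by (simp add: Inv_monoid_def max_ext_Some)
  have assoc: "(\<phi> \<circ>\<^sub>m \<psi>) \<circ>\<^sub>m \<chi> = \<phi> \<circ>\<^sub>m (\<psi> \<circ>\<^sub>m \<chi>)" for \<phi> \<psi> \<chi> :: "'a list \<rightharpoonup> 'a list"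
    by (rule ext) (auto simp: map_comp_def split: option.split)
  have Some: "Some \<circ>\<^sub>m \<phi> = \<phi>" "\<phi> \<circ>\<^sub>m Some = \<phi>" for \<phi> :: "'a list \<rightharpoonup> 'a list"
    by (auto simp: map_comp_def split: option.split)
  show ?thesis
    by (rule monoidI)
      (auto simp: carrier_Inv_monoid mult one assoc Some fg_iso_comp fg_iso_Some)
qed

section \<open>Maps given by relations and by finite tables\<close>

definition map_of_rel :: "('b \<times> 'c) set \<Rightarrow> 'b \<rightharpoonup> 'c" where
  "map_of_rel r x = (if x \<in> Domain r then Some (THE y. (x, y) \<in> r) else None)"

lemma map_of_rel_eq_Some_iff:
  assumes "single_valued r"
  shows "map_of_rel r x = Some y \<longleftrightarrow> (x, y) \<in> r"
proof -
  have "(THE y. (x, y) \<in> r) = y" if "(x, y) \<in> r" for y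
    using that assms by (blast dest: single_valuedD)
  then show ?thesis unfolding map_of_rel_def by auto
qed

definition map_converse :: "('b \<rightharpoonup> 'c) \<Rightarrow> 'c \<rightharpoonup> 'b" where
  "map_converse f = map_of_rel {(y, x). f x = Some y}"

lemma map_converse_eq_Some_iff:
  assumes "fg_iso \<phi>"
  shows "map_converse \<phi> y = Some x \<longleftrightarrow> \<phi> x = Some y"
proof -
  have "single_valued {(y, x). \<phi> x = Some y}"
    by (auto simp: single_valued_def dest: fg_iso_inj[OF assms])
  then show ?thesis by (simp add: map_converse_def map_of_rel_eq_Some_iff)
qed

lemma map_ext_Some: "(\<And>x y. f x = Some y \<longleftrightarrow> g x = Some y) \<Longrightarrow> f = g"
  by (rule ext) (metis not_None_eq)

lemma fg_iso_converse:
  assumes "fg_iso \<phi>"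
  shows "fg_iso (map_converse \<phi>)"
proof -
  note iff = map_converse_eq_Some_iff[OF assms]
  have "dom (map_converse \<phi>) = ran \<phi>" by (auto simp: dom_def ran_def iff)
  then have "fg_right_ideal (dom (map_converse \<phi>))"
    using fg_right_ideal_ran assms unfolding fg_iso_def ideal_iso_def by metis
  moreover have "ideal_iso (map_converse \<phi>)"
    by (rule ideal_isoI) (auto simp: iff ideal_hom_append[OF fg_iso_hom[OF assms]])
  ultimately show ?thesis unfolding fg_iso_def by simp
qed

lemma map_converse_comp:
  assumes "fg_iso \<phi>" "fg_iso \<psi>"
  shows "map_converse (\<phi> \<circ>\<^sub>m \<psi>) = map_converse \<psi> \<circ>\<^sub>m map_converse \<phi>"
  by (rule map_ext_Some)
    (auto simp: map_converse_eq_Some_iff map_comp_Some_iff fg_iso_comp assms)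

definition table :: "('a list \<times> 'a list) set \<Rightarrow> 'a list \<rightharpoonup> 'a list" where
  "table L = map_of_rel {(p @ v, q @ v) | p q v. (p, q) \<in> L}"

definition code_table :: "('a list \<times> 'a list) set \<Rightarrow> bool" where
  "code_table L \<longleftrightarrow> finite L \<and>
     (\<forall>(p, q)\<in>L. \<forall>(p', q')\<in>L. (p, q) \<noteq> (p', q') \<longrightarrow> p \<parallel> p' \<and> q \<parallel> q')"

lemma parallel_append_neq: "p \<parallel> q \<Longrightarrow> p @ v \<noteq> q @ w"
  by (metis parallelE prefixI prefix_same_cases)

lemma table_eq_Some_iff:
  assumes "code_table L"
  shows "table L x = Some y \<longleftrightarrow> (\<exists>p q v. (p, q) \<in> L \<and> x = p @ v \<and> y = q @ v)"
proof -
  have "single_valued {(p @ v, q @ v) | p q v. (p, q) \<in> L}"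
    using assms parallel_append_neq unfolding code_table_def single_valued_def by fastforce
  then show ?thesis unfolding table_def by (subst map_of_rel_eq_Some_iff) auto
qed

lemma fg_iso_table:
  assumes "code_table L"
  shows "fg_iso (table L)"
proof -
  note iff = table_eq_Some_iff[OF assms]
  have "dom (table L) = ideal_gen (fst ` L)"
    by (force simp: dom_def iff ideal_gen_def)
  moreover have "finite (fst ` L)" using assms by (simp add: code_table_def)
  moreover have "ideal_iso (table L)"
  proof (rule ideal_isoI)
    show "table L (x @ w) = Some (y @ w)" if "table L x = Some y" for x y w
      using that unfolding iff by (metis append_assoc)
    show "x = x'" if "table L x = Some y" "table L x' = Some y" for x x' y
      using that assms parallel_append_neq unfolding iff code_table_def by fastforce
  qed
  ultimately show ?thesis unfolding fg_iso_def fg_right_ideal_def by blast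
qed

section \<open>Enumerating a prefix code\<close>

context
  fixes a b :: "'a::finite"
  assumes ab: "a \<noteq> b"
begin

definition push where "push = table {([], [b])}"

definition pop where "pop = table {([a], [])}"

definition absorb where "absorb = table {([a], [a,a]), ([b], [a,b])}"

definition park where
  "park c = table ({([a], [a,a]), ([b,c], [b])} \<union> (\<lambda>d. ([b,d], [a,b,d])) ` (- {c}))"

definition unpark where
  "unpark c = table ({([a,a,a], [a,a]), ([a,b], [a,b]), ([b], [b,c])} \<union>
     (\<lambda>d. ([a,a,b,d], [b,d])) ` (- {c}))"

lemma code_tables:
  "code_table {([], [b])}" "code_table {([a], [])}" "code_table {([a], [a,a]), ([b], [a,b])}"
  "code_table ({([a], [a,a]), ([b,c], [b])} \<union> (\<lambda>d. ([b,d], [a,b,d])) ` (- {c}))"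
  "code_table ({([a,a,a], [a,a]), ([a,b], [a,b]), ([b], [b,c])} \<union>
     (\<lambda>d. ([a,a,b,d], [b,d])) ` (- {c}))"
  using ab by (auto simp: code_table_def parallel_def)

lemmas fg_iso_code_tables = code_tables[THEN fg_iso_table,
    folded push_def pop_def absorb_def park_def unpark_def]

lemma table_rows:
  "(\<exists>p q v. (p, q) \<in> insert (p0, q0) L \<and> x = p @ v \<and> y = q @ v) \<longleftrightarrow>
     (\<exists>v. x = p0 @ v \<and> y = q0 @ v) \<or> (\<exists>p q v. (p, q) \<in> L \<and> x = p @ v \<and> y = q @ v)"
  "(\<exists>p q v. (p, q) \<in> (\<lambda>d. (f d, g d)) ` D \<and> x = p @ v \<and> y = q @ v) \<longleftrightarrow>
     (\<exists>d v. d \<in> D \<and> x = f d @ v \<and> y = g d @ v)"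
  by blast+

lemma generator_iffs:
  "push x = Some y \<longleftrightarrow> y = b # x"
  "pop x = Some y \<longleftrightarrow> x = a # y"
  "absorb x = Some y \<longleftrightarrow> (\<exists>v. x = a # v \<and> y = a # a # v) \<or> (\<exists>v. x = b # v \<and> y = a # b # v)"
  "park c x = Some y \<longleftrightarrow> (\<exists>v. x = a # v \<and> y = a # a # v) \<or> (\<exists>v. x = b # c # v \<and> y = b # v) \<or>
     (\<exists>d v. d \<noteq> c \<and> x = b # d # v \<and> y = a # b # d # v)"
  "unpark c x = Some y \<longleftrightarrow> (\<exists>v. x = a # a # a # v \<and> y = a # a # v) \<or>
     (\<exists>v. x = a # b # v \<and> y = a # b # v) \<or> (\<exists>v. x = b # v \<and> y = b # c # v) \<or>
     (\<exists>d v. d \<noteq> c \<and> x = a # a # b # d # v \<and> y = b # d # v)"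
  unfolding code_tables[THEN table_eq_Some_iff,
      folded push_def pop_def absorb_def park_def unpark_def, unfolded Un_insert_left Un_empty_left]
    table_rows
  by auto

text \<open>This is the map \<open>a \<mapsto> aa\<close>, \<open>b x \<mapsto> ab\<close> that fixes the words of \<open>b A\<^sup>*\<close> incomparable with
  \<open>b x\<close>; it is defined by its factorization so that it visibly lies in the generated submonoid.\<close>

primrec pick :: "'a list \<Rightarrow> 'a list \<rightharpoonup> 'a list" where
  "pick [] = absorb"
| "pick (c # x) = unpark c \<circ>\<^sub>m (pick x \<circ>\<^sub>m park c)"

text \<open>In the recursion step, \<open>park c\<close> strips \<open>c\<close> from the input \<open>b c w\<close> and sends \<open>b d w\<close> with
  \<open>d \<noteq> c\<close> to \<open>a b d w\<close>, next to the old store in \<open>aa A\<^sup>*\<close>. After \<open>pick x\<close> the old store is in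
  \<open>aaa A\<^sup>*\<close>, the parked input in \<open>aab A\<^sup>*\<close>, the picked cone in \<open>ab A\<^sup>*\<close> and the rest in
  \<open>b A\<^sup>*\<close>. These are disjoint, so \<open>unpark c\<close> can restore everything but the picked cone. Words
  \<open>b v\<close> with \<open>v\<close> a proper prefix of \<open>x\<close> are outside the domain.\<close>

lemma pick_iff:
  "pick x w = Some z \<longleftrightarrow>
     (\<exists>v. w = a # v \<and> z = a # a # v) \<or> (\<exists>v. w = b # x @ v \<and> z = a # b # v) \<or>
     (\<exists>v. w = b # v \<and> v \<parallel> x \<and> z = b # v)"
proof (induction x arbitrary: w z)
  case Nil
  show ?case using ab by (auto simp: generator_iffs)
next
  case (Cons c x)
  show ?case (is "_ \<longleftrightarrow> ?R")
  proof
    assume "pick (c # x) w = Some z"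
    then show ?R using ab
      by (auto simp: map_comp_Some_iff Cons.IH generator_iffs parallel_def)
  next
    assume ?R
    then consider v where "w = a # v" "z = a # a # v"
      | v where "w = b # c # x @ v" "z = a # b # v"
      | v where "w = b # c # v" "v \<parallel> x" "z = w"
      | d v where "w = b # d # v" "d \<noteq> c" "z = w"
      by (auto simp: parallel_def neq_Nil_conv)  (metis neq_Nil_conv Cons_prefix_Cons Nil_prefix)
    then show "pick (c # x) w = Some z"
      using ab by cases (auto simp: map_comp_Some_iff Cons.IH generator_iffs)
  qed
qed

primrec gather :: "'a list list \<Rightarrow> 'a list \<rightharpoonup> 'a list" where
  "gather [] = push"
| "gather (x # xs) = pick x \<circ>\<^sub>m gather xs"

text \<open>The code words are pairwise incomparable, so the cone of a word that has not been picked
  yet is left alone by the picks already performed. The first list entry is picked last and thus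
  stored with a single \<open>a\<close>.\<close>

lemma gather_iff:
  assumes "sorted_wrt (\<parallel>) xs"
  shows "gather xs w = Some z \<longleftrightarrow> ((\<forall>x\<in>set xs. w \<parallel> x) \<and> z = b # w) \<or>
     (\<exists>i<length xs. \<exists>v. w = xs ! i @ v \<and> z = replicate (Suc i) a @ b # v)"
  using assms
proof (induction xs arbitrary: z)
  case Nil
  show ?case by (simp add: generator_iffs)
next
  case (Cons x xs)
  have x: "x \<parallel> y" if "y \<in> set xs" for y using Cons.prems that by simp
  note IH = Cons.IH[OF sorted_wrt.simps(2)[THEN iffD1, OF Cons.prems, THEN conjunct2]]
  show ?case (is "_ \<longleftrightarrow> ?R")
  proof
    assume "gather (x # xs) w = Some z"
    then obtain z' where z': "gather xs w = Some z'" "pick x z' = Some z"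
      by (auto simp: map_comp_Some_iff)
    from z'(1)[unfolded IH] show ?R
    proof (elim disjE exE conjE)
      assume w: "\<forall>x\<in>set xs. w \<parallel> x" "z' = b # w"
      with z'(2) ab consider v where "w = x @ v" "z = a # b # v" | "w \<parallel> x" "z = b # w"
        by (auto simp: pick_iff)
      then show ?R using w by cases (force intro: exI[of _ 0])+
    next
      fix i v assume i: "i < length xs" "w = xs ! i @ v" "z' = replicate (Suc i) a @ b # v"
      with z'(2) ab have "z = replicate (Suc (Suc i)) a @ b # v" by (auto simp: pick_iff)
      with i show ?R by (intro disjI2 exI[of _ "Suc i"]) auto
    qed
  next
    assume ?R
    then consider "\<forall>y\<in>set (x # xs). w \<parallel> y" "z = b # w"
      | v where "w = x @ v" "z = a # b # v"
      | i v where "i < length xs" "w = xs ! i @ v" "z = replicate (Suc (Suc i)) a @ b # v"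
      by (auto simp: less_Suc_eq_0_disj)
    then show "gather (x # xs) w = Some z"
    proof cases
      case 1
      then have "gather xs w = Some (b # w)" using IH by auto
      then show ?thesis using 1 by (auto simp: map_comp_Some_iff pick_iff)
    next
      case 2
      then have "\<forall>y\<in>set xs. w \<parallel> y" using x parallel_append[of x _ v "[]"] by auto
      then have "gather xs w = Some (b # w)" using IH by auto
      then show ?thesis using 2 by (auto simp: map_comp_Some_iff pick_iff)
    next
      case 3
      then have "gather xs w = Some (replicate (Suc i) a @ b # v)" using IH by auto
      then show ?thesis using 3 by (auto simp: map_comp_Some_iff pick_iff)
    qed
  qed
qed

definition enum where "enum xs = pop \<circ>\<^sub>m gather xs"

lemma enum_iff:
  assumes "sorted_wrt (\<parallel>) xs"
  shows "enum xs w = Some z \<longleftrightarrow> (\<exists>i<length xs. \<exists>v. w = xs ! i @ v \<and> z = replicate i a @ b # v)"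
  using ab by (auto simp: enum_def map_comp_Some_iff generator_iffs gather_iff[OF assms])

lemma replicate_marker_cancel:
  "replicate i a @ b # v = replicate j a @ b # w \<longleftrightarrow> i = j \<and> v = w"
proof (induction i arbitrary: j)
  case 0
  then show ?case using ab by (cases j) auto
next
  case (Suc i)
  then show ?case using ab by (cases j) auto
qed

definition generators where
  "generators = {push, pop, absorb} \<union> range park \<union> range unpark"

lemma finite_generators: "finite generators"
  by (simp add: generators_def)

lemma fg_iso_generator: "g \<in> generators \<Longrightarrow> fg_iso g"
  using fg_iso_code_tables by (auto simp: generators_def)

text \<open>Applied once to \<open>fg_iso\<close> and once to membership in a submonoid, this is how the
  enumeration maps are seen to be composites of generators.\<close>

lemma enum_induct:
  assumes gen: "\<And>g. g \<in> generators \<Longrightarrow> P g"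
    and comp: "\<And>\<phi> \<psi>. P \<phi> \<Longrightarrow> P \<psi> \<Longrightarrow> P (\<phi> \<circ>\<^sub>m \<psi>)"
  shows "P (enum xs)"
proof -
  have g: "P push" "P pop" "P absorb" "P (park c)" "P (unpark c)" for c
    by (auto intro!: gen simp: generators_def)
  have "P (pick x)" for x
    by (induction x) (auto intro!: g comp)
  then have "P (gather xs)"
    by (induction xs) (auto intro!: g comp)
  then show ?thesis unfolding enum_def by (intro comp g)
qed

lemma fg_iso_enum: "fg_iso (enum xs)"
  by (rule enum_induct) (auto intro: fg_iso_generator fg_iso_comp)

lemma finite_prefix_code:
  assumes "finite C"
  obtains xs where "sorted_wrt (\<parallel>) xs" "ideal_gen C = ideal_gen (set xs)"
proof -
  (* The prefix-minimal elements of C. *)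
  let ?M = "{c \<in> C. \<forall>d\<in>C. prefix d c \<longrightarrow> d = c}"
  obtain xs where xs: "set xs = ?M" "distinct xs"
    using finite_distinct_list[of ?M] assms by auto
  have "sorted_wrt (\<parallel>) xs"
    unfolding sorted_wrt_iff_nth_less
  proof (intro allI impI)
    fix i j assume ij: "i < j" "j < length xs"
    then have "xs ! i \<in> ?M" "xs ! j \<in> ?M" unfolding xs(1)[symmetric] by simp_all
    moreover have "xs ! i \<noteq> xs ! j" using xs(2) ij by (simp add: nth_eq_iff_index_eq)
    ultimately show "xs ! i \<parallel> xs ! j" by (fastforce simp: parallel_def)
  qed
  moreover have "ideal_gen C = ideal_gen ?M"
  proof (rule subset_antisym; rule subsetI)
    fix x assume "x \<in> ideal_gen C"
    then have "\<exists>c. c \<in> C \<and> prefix c x" unfolding ideal_gen_def by auto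
    define c where "c = arg_min length (\<lambda>c. c \<in> C \<and> prefix c x)"
    have c: "c \<in> C" "prefix c x"
      using arg_min_natI[where P = "\<lambda>c. c \<in> C \<and> prefix c x"] \<open>\<exists>c. c \<in> C \<and> prefix c x\<close>
      unfolding c_def by blast+
    have least: "length c \<le> length d" if "d \<in> C" "prefix d x" for d
      using that unfolding c_def by (intro arg_min_nat_le) simp
    have "d = c" if d: "d \<in> C" "prefix d c" for d
    proof -
      have "length c \<le> length d" using least d c prefix_order.trans by blast
      then show ?thesis using d by (auto simp: prefix_def)
    qed
    then have "c \<in> ?M" using c by blast
    then show "x \<in> ideal_gen ?M" using c unfolding ideal_gen_def prefix_def by blast
  qed (auto simp: ideal_gen_def)
  ultimately show thesis using that xs by metis
qed

text \<open>A minimal generating list of the domain is a prefix code, and injectivity makes the list of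
  its images a prefix code as well: \<open>y\<^sub>i v = y\<^sub>j w\<close> forces \<open>x\<^sub>i v = x\<^sub>j w\<close>. Both codes are then
  identified with the same words \<open>a\<^sup>i b\<close>.\<close>

lemma factorization:
  assumes \<phi>: "fg_iso \<phi>"
  obtains xs ys where "\<phi> = map_converse (enum ys) \<circ>\<^sub>m enum xs"
proof -
  note app = ideal_hom_append[OF fg_iso_hom[OF \<phi>]]
  obtain xs where xs: "sorted_wrt (\<parallel>) xs" "dom \<phi> = ideal_gen (set xs)"
    using \<phi> finite_prefix_code unfolding fg_iso_def fg_right_ideal_def by metis
  define ys where "ys = map (\<lambda>x. the (\<phi> x)) xs"
  have \<phi>_nth: "\<phi> (xs ! i) = Some (ys ! i)" if "i < length xs" for i
  proof -
    have "xs ! i @ [] \<in> dom \<phi>"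
      unfolding xs ideal_gen_def using nth_mem[OF that] by blast
    then show ?thesis using that by (auto simp: ys_def)
  qed
  have "sorted_wrt (\<parallel>) ys"
    unfolding sorted_wrt_iff_nth_less
  proof (intro allI impI)
    fix i j assume ij: "i < j" "j < length ys"
    then have xij: "xs ! i \<parallel> xs ! j" using xs by (auto simp: sorted_wrt_iff_nth_less ys_def)
    have cancel: "xs ! i @ v = xs ! j @ w" if "ys ! i @ v = ys ! j @ w" for v w
      using app[OF \<phi>_nth] ij that fg_iso_inj[OF \<phi>] by (simp add: ys_def)
    show "ys ! i \<parallel> ys ! j"
    proof
      show "\<not> prefix (ys ! i) (ys ! j)"
        using cancel[of _ "[]"] parallel_append_neq[OF xij, of _ "[]"] by (auto simp: prefix_def)
      show "\<not> prefix (ys ! j) (ys ! i)"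
        using cancel[of "[]"] parallel_append_neq[OF xij, of "[]"] by (auto simp: prefix_def)
    qed
  qed
  note enum = enum_iff[OF xs(1)] enum_iff[OF this]
  have "\<phi> = map_converse (enum ys) \<circ>\<^sub>m enum xs"
  proof (rule map_ext_Some)
    fix x y
    have "\<phi> x = Some y \<longleftrightarrow> (\<exists>i<length xs. \<exists>v. x = xs ! i @ v \<and> y = ys ! i @ v)" (is "?L \<longleftrightarrow> ?R")
    proof
      assume L: ?L
      then have "x \<in> ideal_gen (set xs)" using xs by blast
      then obtain i v where "i < length xs" "x = xs ! i @ v"
        unfolding ideal_gen_def by (auto simp: in_set_conv_nth)
      then show ?R using app[OF \<phi>_nth] L by auto
    qed (use app[OF \<phi>_nth] in auto)
    also have "\<dots> \<longleftrightarrow> (map_converse (enum ys) \<circ>\<^sub>m enum xs) x = Some y"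
      unfolding map_comp_Some_iff map_converse_eq_Some_iff[OF fg_iso_enum] enum
      by (auto simp: ys_def replicate_marker_cancel)
    finally show "\<phi> x = Some y \<longleftrightarrow> (map_converse (enum ys) \<circ>\<^sub>m enum xs) x = Some y" .
  qed
  then show thesis by (rule that)
qed

lemma finitely_generated_Inv_monoid:
  "finitely_generated_monoid (Inv_monoid :: ('a list \<rightharpoonup> 'a list) monoid)"
proof -
  let ?M = "Inv_monoid :: ('a list \<rightharpoonup> 'a list) monoid"
  let ?S = "max_ext ` (generators \<union> map_converse ` generators)"
  interpret monoid ?M by (rule monoid_Inv_monoid)
  have S: "finite ?S" "?S \<subseteq> carrier ?M"
    using finite_generators fg_iso_generator fg_iso_converse by (auto simp: carrier_Inv_monoid)
  have "carrier ?M \<subseteq> H" if H: "submonoid H ?M" "?S \<subseteq> H" for H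
  proof
    have comp: "max_ext (\<phi> \<circ>\<^sub>m \<psi>) \<in> H"
      if "fg_iso \<phi>" "max_ext \<phi> \<in> H" "fg_iso \<psi>" "max_ext \<psi> \<in> H" for \<phi> \<psi>
      using submonoid.m_closed[OF H(1) that(2,4)] max_ext_comp[of \<phi> \<psi>] that(1,3)
      by (simp add: Inv_monoid_def fg_iso_hom)
    (* Membership of the inverse is carried along in the induction, which avoids relating
       max_ext to inverses: inverting reverses composites before extensions are taken. *)
    have enum: "fg_iso (enum xs) \<and> max_ext (enum xs) \<in> H \<and> max_ext (map_converse (enum xs)) \<in> H" for xs
    proof (rule enum_induct)
      show "fg_iso g \<and> max_ext g \<in> H \<and> max_ext (map_converse g) \<in> H" if "g \<in> generators" for g
        using that H(2) fg_iso_generator by auto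
    qed (simp add: fg_iso_comp comp map_converse_comp fg_iso_converse)
    fix \<mu> assume "\<mu> \<in> carrier ?M"
    then obtain \<phi> where \<phi>: "fg_iso \<phi>" "\<mu> = max_ext \<phi>" unfolding carrier_Inv_monoid by blast
    from \<phi>(1) obtain xs ys where "\<phi> = map_converse (enum ys) \<circ>\<^sub>m enum xs" by (rule factorization)
    then show "\<mu> \<in> H" using \<phi>(2) enum comp fg_iso_converse by metis
  qed
  moreover have "submonoid (carrier ?M) ?M" by unfold_locales auto
  ultimately have "\<Inter>{H. submonoid H ?M \<and> ?S \<subseteq> H} = carrier ?M" using S(2) by blast
  with S monoid_Inv_monoid show ?thesis unfolding finitely_generated_monoid_def by blast
qed

end

theorem theorem3p4:
  fixes k :: nat
  assumes "card (UNIV :: 'a::finite set) = k" and "k \<ge> 2"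
  shows "finitely_generated_monoid (Inv_monoid :: ('a list \<rightharpoonup> 'a list) monoid)"
proof -
  obtain a b :: 'a where "a \<noteq> b"
    using assms card_le_Suc0_iff_eq[of "UNIV :: 'a set"] by force
  then show ?thesis by (rule finitely_generated_Inv_monoid)
qed

end
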